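(* Let $\mathcal{H}$ be a separable Hilbert space, and let $\Phi$ and $\Psi$ be frames for $\mathcal{H}$ (indexed by $I$) with duals $\Phi^d$ and $\Psi^d$, respectively; let $B_\Phi,B_{\Phi^d},B_{\Psi^d}$ be Bessel bounds of $\Phi,\Phi^d,\Psi^d$. Then: (1) $\Phi$ and $\Psi$ are approximate dual frames if $\|I_{\ell^2}-\mathbf{G}_{\Psi,\Phi}\|<\dfrac{1}{\sqrt{B_\Phi B_{\Phi^d}}}$. (2) $\Phi^d$ and $\Psi^d$ are approximate dual frames if $\|I_{\ell^2}-\mathbf{G}_{\Phi,\Psi}\|<\dfrac{1}{\sqrt{B_{\Phi^d}B_{\Psi^d}}}$. (3) $\Phi$ and $\Psi$ are approximate dual frames if $\|I_{\ell^2}-\mathbf{G}_{\Phi,\Psi}\|<\dfrac{1}{\sqrt{B_\Phi B_{\Phi^d}}}$. (4) Let $U\in\mathcal{B}(\mathcal{H})$. If $V\in\mathcal{B}(\mathcal{H})$ is a right inverse of $U$ such that $\|I_{\ell^2}-\mathbf{G}_{U,\Psi,\Phi}\mathbf{G}_{V,\Phi^d,\Phi}\|<\dfrac{1}{\sqrt{B_\Phi B_{\Phi^d}}}$, then $\Phi$ and $\Psi$ are approximate dual frames.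
   Context: All Hilbert spaces are separable, $I$ is a countable index set, $\ell^2=\ell^2(I)$, $\mathcal{B}(\mathcal{H})$ is the set of bounded linear operators on $\mathcal{H}$. A sequence $\Phi=\{\phi_i\}_{i\in I}$ in $\mathcal{H}$ is a Bessel sequence with Bessel bound $B_\Phi>0$ if $\sum_{i}|\langle f,\phi_i\rangle|^2\le B_\Phi\|f\|^2$ for all $f\in\mathcal{H}$, and a frame if moreover $A_\Phi\|f\|^2\le\sum_i|\langle f,\phi_i\rangle|^2$ for some $A_\Phi>0$ and all $f$. The synthesis operator is $T_\Phi:\ell^2\to\mathcal{H}$, $T_\Phi\{c_i\}=\sum_ic_i\phi_i$, with adjoint $T_\Phi^*f=\{\langle f,\phi_i\rangle\}_i$. A dual of a Bessel sequence $\Phi$ is a Bessel sequence $\Phi^d=\{\phi_i^d\}$ with $f=\sum_i\langle f,\phi_i^d\rangle\phi_i$ for all $f\in\mathcal{H}$. Bessel sequences $\Phi,\Psi$ are called approximate dual frames if $\|T_\Phi T_\Psi^*-I_{\mathcal{H}}\|<1$ or $\|T_\Psi T_\Phi^*-I_{\mathcal{H}}\|<1$. The $U$-cross Gram matrix is $(\mathbf{G}_{U,\Phi,\Psi})_{i,j}=\langle U\psi_j,\phi_i\rangle$, equivalently the bounded operator $T_\Phi^*UT_\Psi$ on $\ell^2$; $\mathbf{G}_{\Phi,\Psi}=\mathbf{G}_{I_{\mathcal{H}},\Phi,\Psi}=T_\Phi^*T_\Psi$. *)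

theory Defs
  imports "HOL-Analysis.Analysis"
begin

section \<open>Complex Hilbert spaces\<close>

text \<open>
  The library only has real inner product spaces. The inner product below is linear in the
  first and conjugate-linear in the second argument.
\<close>

class complex_inner = real_normed_vector +
  fixes scaleC :: "complex \<Rightarrow> 'a \<Rightarrow> 'a" (infixr \<open>*\<^sub>C\<close> 75)
    and cinner :: "'a \<Rightarrow> 'a \<Rightarrow> complex"
  assumes scaleC_add_right: "a *\<^sub>C (x + y) = a *\<^sub>C x + a *\<^sub>C y"
    and scaleC_add_left: "(a + b) *\<^sub>C x = a *\<^sub>C x + b *\<^sub>C x"
    and scaleC_scaleC: "a *\<^sub>C b *\<^sub>C x = (a * b) *\<^sub>C x"
    and scaleC_of_real: "complex_of_real r *\<^sub>C x = r *\<^sub>R x"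
    and cinner_commute: "cinner x y = cnj (cinner y x)"
    and cinner_add_left: "cinner (x + y) z = cinner x z + cinner y z"
    and cinner_scaleC_left: "cinner (a *\<^sub>C x) y = a * cinner x y"
    and cinner_self: "cinner x x = complex_of_real ((norm x)\<^sup>2)"

class chilbert_space = complex_inner + banach

instantiation complex :: chilbert_space
begin

definition scaleC_complex :: "complex \<Rightarrow> complex \<Rightarrow> complex" where
  "scaleC_complex a x = a * x"

definition cinner_complex :: "complex \<Rightarrow> complex \<Rightarrow> complex" where
  "cinner_complex x y = x * cnj y"

instance
proof
  fix a b x y z :: complex and r :: real
  show "cinner x x = complex_of_real ((norm x)\<^sup>2)"
    by (simp only: cinner_complex_def complex_norm_square)
qed (simp_all add: scaleC_complex_def cinner_complex_def ring_distribs scaleR_conv_of_real)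

end

definition bounded_clinear :: "('a::complex_inner \<Rightarrow> 'b::complex_inner) \<Rightarrow> bool" where
  "bounded_clinear U \<longleftrightarrow> bounded_linear U \<and> (\<forall>a x. U (a *\<^sub>C x) = a *\<^sub>C U x)"


section \<open>Square-summable families\<close>

typedef 'i ell2 = "{c :: 'i \<Rightarrow> complex. (\<lambda>i. (cmod (c i))\<^sup>2) summable_on UNIV}"
  morphisms ell2_nth Abs_ell2
  by (rule exI[of _ "\<lambda>_. 0"]) simp

setup_lifting type_definition_ell2

lemma L2_set_le_infsum:
  fixes c :: "'i \<Rightarrow> complex"
  assumes "(\<lambda>i. (cmod (c i))\<^sup>2) summable_on UNIV" "finite F"
  shows "L2_set (\<lambda>i. cmod (c i)) F \<le> sqrt (\<Sum>\<^sub>\<infinity>i. (cmod (c i))\<^sup>2)"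
  unfolding L2_set_def using assms
  by (intro real_sqrt_le_mono finite_sum_le_infsum) auto

lemma ell2_add_finite:
  fixes c d :: "'i \<Rightarrow> complex"
  assumes c: "(\<lambda>i. (cmod (c i))\<^sup>2) summable_on UNIV"
    and d: "(\<lambda>i. (cmod (d i))\<^sup>2) summable_on UNIV" and F: "finite F"
  shows "(\<Sum>i\<in>F. (cmod (c i + d i))\<^sup>2) \<le>
    (sqrt (\<Sum>\<^sub>\<infinity>i. (cmod (c i))\<^sup>2) + sqrt (\<Sum>\<^sub>\<infinity>i. (cmod (d i))\<^sup>2))\<^sup>2"
proof -
  have "L2_set (\<lambda>i. cmod (c i + d i)) F \<le> L2_set (\<lambda>i. cmod (c i) + cmod (d i)) F"
    by (intro L2_set_mono) (auto intro: norm_triangle_ineq)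
  also have "\<dots> \<le> L2_set (\<lambda>i. cmod (c i)) F + L2_set (\<lambda>i. cmod (d i)) F"
    by (rule L2_set_triangle_ineq)
  also have "\<dots> \<le> sqrt (\<Sum>\<^sub>\<infinity>i. (cmod (c i))\<^sup>2) + sqrt (\<Sum>\<^sub>\<infinity>i. (cmod (d i))\<^sup>2)"
    by (intro add_mono L2_set_le_infsum c d F)
  finally have "(L2_set (\<lambda>i. cmod (c i + d i)) F)\<^sup>2 \<le>
      (sqrt (\<Sum>\<^sub>\<infinity>i. (cmod (c i))\<^sup>2) + sqrt (\<Sum>\<^sub>\<infinity>i. (cmod (d i))\<^sup>2))\<^sup>2"
    by (intro power_mono) auto
  then show ?thesis
    by (simp add: L2_set_def sum_nonneg)
qed

lemma ell2_add_summable: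
  fixes c d :: "'i \<Rightarrow> complex"
  assumes "(\<lambda>i. (cmod (c i))\<^sup>2) summable_on UNIV" "(\<lambda>i. (cmod (d i))\<^sup>2) summable_on UNIV"
  shows "(\<lambda>i. (cmod (c i + d i))\<^sup>2) summable_on UNIV"
  using ell2_add_finite[OF assms]
  by (intro nonneg_bounded_partial_sums_imp_summable_on eventually_finite_subsets_at_top_weakI)
    auto

instantiation ell2 :: (type) real_normed_vector
begin

lift_definition zero_ell2 :: "'a ell2" is "\<lambda>_. 0" by simp

lift_definition uminus_ell2 :: "'a ell2 \<Rightarrow> 'a ell2" is "\<lambda>c i. - c i" by simp

lift_definition plus_ell2 :: "'a ell2 \<Rightarrow> 'a ell2 \<Rightarrow> 'a ell2" is "\<lambda>c d i. c i + d i"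
  by (rule ell2_add_summable)

lift_definition minus_ell2 :: "'a ell2 \<Rightarrow> 'a ell2 \<Rightarrow> 'a ell2" is "\<lambda>c d i. c i - d i"
proof -
  fix c d :: "'a \<Rightarrow> complex"
  assume "(\<lambda>i. (cmod (c i))\<^sup>2) summable_on UNIV" "(\<lambda>i. (cmod (d i))\<^sup>2) summable_on UNIV"
  then show "(\<lambda>i. (cmod (c i - d i))\<^sup>2) summable_on UNIV"
    using ell2_add_summable[of c "\<lambda>i. - d i"] by simp
qed

lift_definition scaleR_ell2 :: "real \<Rightarrow> 'a ell2 \<Rightarrow> 'a ell2" is "\<lambda>r c i. r *\<^sub>R c i"
  by (simp add: power_mult_distrib summable_on_cmult_right)

lift_definition norm_ell2 :: "'a ell2 \<Rightarrow> real" is "\<lambda>c. sqrt (\<Sum>\<^sub>\<infinity>i. (cmod (c i))\<^sup>2)" .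

definition dist_ell2 :: "'a ell2 \<Rightarrow> 'a ell2 \<Rightarrow> real" where
  "dist_ell2 c d = norm (c - d)"

definition sgn_ell2 :: "'a ell2 \<Rightarrow> 'a ell2" where
  "sgn_ell2 c = inverse (norm c) *\<^sub>R c"

definition uniformity_ell2 :: "('a ell2 \<times> 'a ell2) filter" where
  "uniformity_ell2 = (INF e\<in>{0<..}. principal {(x, y). dist x y < e})"

definition open_ell2 :: "'a ell2 set \<Rightarrow> bool" where
  "open_ell2 U = (\<forall>x\<in>U. \<forall>\<^sub>F (x', y) in uniformity. x' = x \<longrightarrow> y \<in> U)"

instance
proof
  fix a b :: real and x y z :: "'a ell2"
  show "x + y + z = x + (y + z)" by transfer (simp add: add.assoc)
  show "x + y = y + x" by transfer (simp add: add.commute)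
  show "0 + x = x" by transfer simp
  show "- x + x = 0" by transfer simp
  show "x - y = x + - y" by transfer simp
  show "a *\<^sub>R (x + y) = a *\<^sub>R x + a *\<^sub>R y" by transfer (simp add: scaleR_add_right)
  show "(a + b) *\<^sub>R x = a *\<^sub>R x + b *\<^sub>R x" by transfer (simp add: scaleR_add_left)
  show "a *\<^sub>R b *\<^sub>R x = (a * b) *\<^sub>R x" by transfer simp
  show "1 *\<^sub>R x = x" by transfer simp
  show "dist x y = norm (x - y)" by (rule dist_ell2_def)
  show "sgn x = inverse (norm x) *\<^sub>R x" by (rule sgn_ell2_def)
  show "uniformity = (INF e\<in>{0<..}. principal {(x, y :: 'a ell2). dist x y < e})"
    by (rule uniformity_ell2_def)
  show "open U = (\<forall>x\<in>U. \<forall>\<^sub>F (x', y) in uniformity. x' = x \<longrightarrow> y \<in> U)" for U :: "'a ell2 set"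
    by (rule open_ell2_def)
  show "norm x = 0 \<longleftrightarrow> x = 0"
  proof transfer
    fix c :: "'a \<Rightarrow> complex"
    assume c: "(\<lambda>i. (cmod (c i))\<^sup>2) summable_on UNIV"
    show "sqrt (\<Sum>\<^sub>\<infinity>i. (cmod (c i))\<^sup>2) = 0 \<longleftrightarrow> c = (\<lambda>_. 0)"
    proof
      assume "sqrt (\<Sum>\<^sub>\<infinity>i. (cmod (c i))\<^sup>2) = 0"
      then have 0: "(\<Sum>\<^sub>\<infinity>i. (cmod (c i))\<^sup>2) \<le> 0" by simp
      have "c i = 0" for i
        using nonneg_infsum_le_0D[OF 0 c, of i] by simp
      then show "c = (\<lambda>_. 0)" by (rule ext)
    qed simp
  qed
  show "norm (x + y) \<le> norm x + norm y"
  proof transfer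
    fix c d :: "'a \<Rightarrow> complex"
    assume c: "(\<lambda>i. (cmod (c i))\<^sup>2) summable_on UNIV"
      and d: "(\<lambda>i. (cmod (d i))\<^sup>2) summable_on UNIV"
    have "(\<Sum>\<^sub>\<infinity>i. (cmod (c i + d i))\<^sup>2) \<le>
        (sqrt (\<Sum>\<^sub>\<infinity>i. (cmod (c i))\<^sup>2) + sqrt (\<Sum>\<^sub>\<infinity>i. (cmod (d i))\<^sup>2))\<^sup>2"
      using ell2_add_summable[OF c d] ell2_add_finite[OF c d]
      by (intro infsum_le_finite_sums) auto
    then show "sqrt (\<Sum>\<^sub>\<infinity>i. (cmod (c i + d i))\<^sup>2) \<le>
        sqrt (\<Sum>\<^sub>\<infinity>i. (cmod (c i))\<^sup>2) + sqrt (\<Sum>\<^sub>\<infinity>i. (cmod (d i))\<^sup>2)"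
      by (intro real_le_lsqrt add_nonneg_nonneg) (auto intro: infsum_nonneg)
  qed
  show "norm (a *\<^sub>R x) = \<bar>a\<bar> * norm x"
    by transfer (simp add: power_mult_distrib infsum_cmult_right' real_sqrt_mult)
qed

end


section \<open>Frames, duals and cross Gram matrices\<close>

text \<open>
  The index set is a type, usually of class \<open>countable\<close>. All series are
  unconditional sums over that type.
\<close>

definition bessel_bound :: "('i \<Rightarrow> 'h::complex_inner) \<Rightarrow> real \<Rightarrow> bool" where
  "bessel_bound \<Phi> B \<longleftrightarrow> B > 0 \<and>
    (\<forall>f. (\<lambda>i. (cmod (cinner f (\<Phi> i)))\<^sup>2) summable_on UNIV \<and>
      (\<Sum>\<^sub>\<infinity>i. (cmod (cinner f (\<Phi> i)))\<^sup>2) \<le> B * (norm f)\<^sup>2)"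

definition bessel :: "('i \<Rightarrow> 'h::complex_inner) \<Rightarrow> bool" where
  "bessel \<Phi> \<longleftrightarrow> (\<exists>B. bessel_bound \<Phi> B)"

definition frame :: "('i \<Rightarrow> 'h::complex_inner) \<Rightarrow> bool" where
  "frame \<Phi> \<longleftrightarrow> bessel \<Phi> \<and>
    (\<exists>A>0. \<forall>f. A * (norm f)\<^sup>2 \<le> (\<Sum>\<^sub>\<infinity>i. (cmod (cinner f (\<Phi> i)))\<^sup>2))"

definition dual_of :: "('i \<Rightarrow> 'h::complex_inner) \<Rightarrow> ('i \<Rightarrow> 'h) \<Rightarrow> bool" where
  "dual_of \<Phi>d \<Phi> \<longleftrightarrow> bessel \<Phi>d \<and>
    (\<forall>f. ((\<lambda>i. cinner f (\<Phi>d i) *\<^sub>C \<Phi> i) has_sum f) UNIV)"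

definition synthesis :: "('i \<Rightarrow> 'h::complex_inner) \<Rightarrow> 'i ell2 \<Rightarrow> 'h" where
  "synthesis \<Phi> c = (\<Sum>\<^sub>\<infinity>i. ell2_nth c i *\<^sub>C \<Phi> i)"

text \<open>The adjoint of \<open>synthesis \<Phi>\<close>; only meaningful if \<open>\<Phi>\<close> is Bessel.\<close>

definition analysis :: "('i \<Rightarrow> 'h::complex_inner) \<Rightarrow> 'h \<Rightarrow> 'i ell2" where
  "analysis \<Phi> f = Abs_ell2 (\<lambda>i. cinner f (\<Phi> i))"

definition approx_dual_frames :: "('i \<Rightarrow> 'h::complex_inner) \<Rightarrow> ('i \<Rightarrow> 'h) \<Rightarrow> bool" where
  "approx_dual_frames \<Phi> \<Psi> \<longleftrightarrow> bessel \<Phi> \<and> bessel \<Psi> \<and>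
    (onorm (\<lambda>f. synthesis \<Phi> (analysis \<Psi> f) - f) < 1 \<or>
     onorm (\<lambda>f. synthesis \<Psi> (analysis \<Phi> f) - f) < 1)"

definition cross_gram_matrix ::
  "('h::complex_inner \<Rightarrow> 'h) \<Rightarrow> ('i \<Rightarrow> 'h) \<Rightarrow> ('i \<Rightarrow> 'h) \<Rightarrow> 'i \<Rightarrow> 'i \<Rightarrow> complex" where
  "cross_gram_matrix U \<Phi> \<Psi> i j = cinner (U (\<Psi> j)) (\<Phi> i)"

text \<open>Only meaningful for matrices that map square-summable families to such families.\<close>

definition matrix_op :: "('i \<Rightarrow> 'i \<Rightarrow> complex) \<Rightarrow> 'i ell2 \<Rightarrow> 'i ell2" where
  "matrix_op M c = Abs_ell2 (\<lambda>i. \<Sum>\<^sub>\<infinity>j. M i j * ell2_nth c j)"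

definition cross_gram ::
  "('h::complex_inner \<Rightarrow> 'h) \<Rightarrow> ('i \<Rightarrow> 'h) \<Rightarrow> ('i \<Rightarrow> 'h) \<Rightarrow> 'i ell2 \<Rightarrow> 'i ell2" where
  "cross_gram U \<Phi> \<Psi> = matrix_op (cross_gram_matrix U \<Phi> \<Psi>)"

abbreviation gram :: "('i \<Rightarrow> 'h::complex_inner) \<Rightarrow> ('i \<Rightarrow> 'h) \<Rightarrow> 'i ell2 \<Rightarrow> 'i ell2" where
  "gram \<equiv> cross_gram id"

end

theory Submission
  imports Defs
begin

text \<open>
  Write \<open>T\<close>, \<open>S\<close>, \<open>D\<close>, \<open>E\<close> for the synthesis operators of \<open>\<Phi>\<close>, \<open>\<Psi>\<close>, \<open>\<Phi>d\<close>, \<open>\<Psi>d\<close> and a star for the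
  corresponding analysis operator. Duality says \<open>TD* = I\<close> and \<open>SE* = I\<close>; it is symmetric, so also
  \<open>DT* = I\<close> (lemma \<open>dual_synthesis_analysis\<close>). A Gram matrix is a composition of analysis after
  synthesis (lemma \<open>cross_gram_eq\<close>), so compressing its distance from the identity of \<open>\<ell>\<^sup>2\<close> between a
  synthesis operator on the left and an analysis operator on the right lets dual pairs of
  factors cancel:

    \<^item> \<open>T(I - S*T)D* = I - TS*\<close>, which gives the first claim;
    \<^item> \<open>D(I - T*S)E* = DE* - I\<close>, which gives the second;
    \<^item> \<open>D(I - T*S)T* = I - ST*\<close>, which gives the third.

  A synthesis or analysis operator has norm at most the square root of a Bessel bound, so in each
  case the hypothesis makes the norm of the left-hand side less than 1 (lemma
  \<open>onorm_compressed_defect_less_1\<close>). The fourth claim is the first one in disguise, because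
  \<open>(S*UT)(D*VT) = S*U(TD*)VT = S*(UV)T = S*T\<close>.

  What remains is that synthesis is well defined and bounded: for a Bessel sequence the series
  \<open>\<Sum> c\<^sub>i \<phi>\<^sub>i\<close> converges unconditionally, with the right bound, by a Cauchy-Schwarz estimate on
  finite partial sums (lemma \<open>norm_finite_synthesis_le\<close>).
\<close>

section \<open>The inner product\<close>

lemma cinner_zero_left: "cinner 0 y = 0"
  using cinner_add_left[of 0 0 y] by simp

lemma cinner_diff_left: "cinner (x - y) z = cinner x z - cinner y z"
  using cinner_add_left[of "x - y" y z] by simp

lemma cinner_scaleR_left: "cinner (r *\<^sub>R x) y = r *\<^sub>R cinner x y"
  using cinner_scaleC_left[of "complex_of_real r" x y]
  by (simp add: scaleC_of_real scaleR_conv_of_real)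

lemma cinner_sum_left: "cinner (\<Sum>i\<in>F. f i) y = (\<Sum>i\<in>F. cinner (f i) y)"
  by (induction F rule: infinite_finite_induct) (auto simp: cinner_zero_left cinner_add_left)

lemma cinner_eqI:
  assumes "\<And>g. cinner x g = cinner y g"
  shows "x = y"
proof -
  have "cinner (x - y) (x - y) = 0"
    by (simp add: cinner_diff_left assms)
  then show ?thesis
    by (simp add: cinner_self)
qed

lemma cinner_Cauchy_Schwarz: "cmod (cinner x y) \<le> norm x * norm y"
proof (cases "y = 0")
  case True
  then show ?thesis
    using cinner_commute[of x y] by (simp add: cinner_zero_left)
next
  case False
  \<comment> \<open>\<open>a *\<^sub>C y\<close> is the orthogonal projection of \<open>x\<close> onto the line through \<open>y\<close>.\<close>
  define a where "a = cinner x y / complex_of_real ((norm y)\<^sup>2)"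
  define z where "z = x - a *\<^sub>C y"
  have "cinner z y = 0"
    using False by (simp add: z_def a_def cinner_diff_left cinner_scaleC_left cinner_self)
  then have "cinner y z = 0"
    using cinner_commute[of y z] by simp
  then have "cinner z z = cinner x z"
    by (simp add: z_def cinner_diff_left cinner_scaleC_left)
  also have "\<dots> = cnj (cinner z x)"
    by (rule cinner_commute)
  also have "\<dots> = complex_of_real ((norm x)\<^sup>2) - cnj (a * cnj (cinner x y))"
    by (simp add: z_def cinner_diff_left cinner_scaleC_left cinner_self flip: cinner_commute)
  also have "\<dots> = complex_of_real ((norm x)\<^sup>2 - (cmod (cinner x y))\<^sup>2 / (norm y)\<^sup>2)"
    by (simp add: a_def mult.commute flip: complex_norm_square)
  finally have "(norm z)\<^sup>2 = (norm x)\<^sup>2 - (cmod (cinner x y))\<^sup>2 / (norm y)\<^sup>2"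
    by (simp only: cinner_self of_real_eq_iff)
  then have "(cmod (cinner x y))\<^sup>2 / (norm y)\<^sup>2 \<le> (norm x)\<^sup>2"
    using zero_le_power2[of "norm z"] by linarith
  then have "(cmod (cinner x y))\<^sup>2 \<le> (norm x * norm y)\<^sup>2"
    using False by (simp add: divide_le_eq power_mult_distrib)
  then show ?thesis
    by (rule power2_le_imp_le) simp
qed

lemma bounded_linear_cinner_left:
  fixes y :: "'h::complex_inner"
  shows "bounded_linear (\<lambda>x. cinner x y)"
proof (rule bounded_linear_intro[where K = "norm y"])
  show "cinner (a + b) y = cinner a y + cinner b y" for a b by (rule cinner_add_left)
  show "cinner (r *\<^sub>R x) y = r *\<^sub>R cinner x y" for r x by (rule cinner_scaleR_left)
  show "cmod (cinner x y) \<le> norm x * norm y" for x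
    by (rule cinner_Cauchy_Schwarz)
qed

section \<open>Sums in Hilbert space\<close>

text \<open>
  The Cauchy criterion for unconditional summability. It is needed because a synthesis series
  need not converge absolutely.
\<close>

lemma summable_on_if_small_tails:
  fixes f :: "'a \<Rightarrow> 'b::banach"
  assumes small: "\<And>e. e > 0 \<Longrightarrow> \<exists>F0. finite F0 \<and> F0 \<subseteq> A \<and>
    (\<forall>F. finite F \<and> F \<subseteq> A \<and> F \<inter> F0 = {} \<longrightarrow> norm (sum f F) < e)"
  shows "f summable_on A"
proof -
  have "\<exists>P. eventually P (finite_subsets_at_top A) \<and>
      (\<forall>F F'. P F \<and> P F' \<longrightarrow> dist (sum f F) (sum f F') < e)" if "e > 0" for e
  proof -
    obtain F0 where "finite F0 \<and> F0 \<subseteq> A \<and>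
        (\<forall>F. finite F \<and> F \<subseteq> A \<and> F \<inter> F0 = {} \<longrightarrow> norm (sum f F) < e / 2)"
      using small[OF half_gt_zero[OF \<open>e > 0\<close>]] by (rule exE)
    then have F0: "finite F0" "F0 \<subseteq> A"
      and tail: "\<And>F. finite F \<and> F \<subseteq> A \<and> F \<inter> F0 = {} \<Longrightarrow> norm (sum f F) < e / 2"
      by simp_all
    define P where "P F \<longleftrightarrow> finite F \<and> F0 \<subseteq> F \<and> F \<subseteq> A" for F
    have "eventually P (finite_subsets_at_top A)"
      unfolding eventually_finite_subsets_at_top P_def using F0 by (intro exI[of _ F0]) simp
    moreover have "dist (sum f F) (sum f F') < e" if "P F" "P F'" for F F'
    proof -
      have near: "dist (sum f F) (sum f F0) < e / 2" if "P F" for F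
      proof -
        have "sum f F - sum f F0 = sum f (F - F0)"
          using that F0 by (subst sum_diff) (auto simp: P_def)
        then show ?thesis
          using tail[of "F - F0"] that by (auto simp: P_def dist_norm)
      qed
      show ?thesis
        using near[OF \<open>P F\<close>] near[OF \<open>P F'\<close>] by (rule dist_triangle_half_l)
    qed
    ultimately show ?thesis by (intro exI[of _ P]) simp
  qed
  then have "cauchy_filter (filtermap (sum f) (finite_subsets_at_top A))"
    by (simp add: cauchy_filter_metric_filtermap)
  then have "convergent_filter (filtermap (sum f) (finite_subsets_at_top A))"
    by (rule cauchy_filter_convergent)
  then show ?thesis
    by (auto simp: convergent_filter_iff summable_on_def has_sum_def filterlim_def)
qed

section \<open>Analysis and synthesis of Bessel sequences\<close>

lemma bessel_bound_pos: "bessel_bound \<Phi> B \<Longrightarrow> B > 0"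
  by (simp add: bessel_bound_def)

lemma bessel_bound_imp_bessel: "bessel_bound \<Phi> B \<Longrightarrow> bessel \<Phi>"
  by (auto simp: bessel_def)

lemma bessel_bound_L2_set:
  assumes "bessel_bound \<Phi> B" "finite F"
  shows "L2_set (\<lambda>i. cmod (cinner x (\<Phi> i))) F \<le> sqrt B * norm x"
proof -
  have "L2_set (\<lambda>i. cmod (cinner x (\<Phi> i))) F \<le> sqrt (\<Sum>\<^sub>\<infinity>i. (cmod (cinner x (\<Phi> i)))\<^sup>2)"
    using assms by (intro L2_set_le_infsum) (auto simp: bessel_bound_def)
  also have "\<dots> \<le> sqrt (B * (norm x)\<^sup>2)"
    using assms by (intro real_sqrt_le_mono) (auto simp: bessel_bound_def)
  finally show ?thesis
    by (simp add: real_sqrt_mult)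
qed

text \<open>
  For \<open>x = \<Sum> a\<^sub>i \<phi>\<^sub>i\<close>, expanding only the first argument of \<open>cinner x x\<close> pairs the coefficients with
  the analysis coefficients of \<open>x\<close> itself. The Cauchy-Schwarz inequality for finite sums and the
  Bessel bound then yield \<open>\<parallel>x\<parallel>\<^sup>2 \<le> \<parallel>a\<parallel> \<surd>B \<parallel>x\<parallel>\<close>, and one factor \<open>\<parallel>x\<parallel>\<close> cancels.
\<close>

lemma norm_finite_synthesis_le:
  assumes B: "bessel_bound \<Phi> B" and F: "finite F"
  shows "norm (\<Sum>i\<in>F. a i *\<^sub>C \<Phi> i) \<le> sqrt B * L2_set (\<lambda>i. cmod (a i)) F"
proof -
  define x where "x = (\<Sum>i\<in>F. a i *\<^sub>C \<Phi> i)"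
  have "complex_of_real ((norm x)\<^sup>2) = cinner (\<Sum>i\<in>F. a i *\<^sub>C \<Phi> i) x"
    by (simp only: cinner_self flip: x_def)
  also have "\<dots> = (\<Sum>i\<in>F. a i * cnj (cinner x (\<Phi> i)))"
    by (simp add: cinner_sum_left cinner_scaleC_left flip: cinner_commute)
  finally have "(norm x)\<^sup>2 = cmod (\<Sum>i\<in>F. a i * cnj (cinner x (\<Phi> i)))"
    by (metis abs_of_nonneg norm_of_real zero_le_power2)
  also have "\<dots> \<le> (\<Sum>i\<in>F. \<bar>cmod (a i)\<bar> * \<bar>cmod (cinner x (\<Phi> i))\<bar>)"
    by (rule order_trans[OF norm_sum]) (simp add: norm_mult)
  also have "\<dots> \<le> L2_set (\<lambda>i. cmod (a i)) F * L2_set (\<lambda>i. cmod (cinner x (\<Phi> i))) F"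
    by (rule L2_set_mult_ineq)
  also have "\<dots> \<le> L2_set (\<lambda>i. cmod (a i)) F * (sqrt B * norm x)"
    by (intro mult_left_mono bessel_bound_L2_set[OF B F] L2_set_nonneg)
  finally have "norm x * norm x \<le> (sqrt B * L2_set (\<lambda>i. cmod (a i)) F) * norm x"
    by (simp add: power2_eq_square mult_ac)
  moreover have "0 \<le> sqrt B * L2_set (\<lambda>i. cmod (a i)) F"
    using bessel_bound_pos[OF B] by simp
  ultimately have "norm x \<le> sqrt B * L2_set (\<lambda>i. cmod (a i)) F"
    by (cases "norm x = 0") (simp_all add: mult_le_cancel_right)
  then show ?thesis
    by (simp add: x_def)
qed

lemma ell2_nth_summable: "(\<lambda>i. (cmod (ell2_nth c i))\<^sup>2) summable_on UNIV"
  using ell2_nth by blast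

lemma L2_set_ell2_le_norm: "finite F \<Longrightarrow> L2_set (\<lambda>i. cmod (ell2_nth c i)) F \<le> norm c"
  unfolding norm_ell2.rep_eq by (rule L2_set_le_infsum[OF ell2_nth_summable])

lemma ell2_small_tails:
  assumes "e > 0"
  shows "\<exists>F0. finite F0 \<and> (\<forall>F. finite F \<and> F \<inter> F0 = {} \<longrightarrow>
    L2_set (\<lambda>i. cmod (ell2_nth c i)) F < e)"
proof -
  let ?q = "\<lambda>i. (cmod (ell2_nth c i))\<^sup>2"
  obtain F0 where F0: "finite F0" "dist (sum ?q F0) (infsum ?q UNIV) \<le> e\<^sup>2 / 2"
    using infsum_finite_approximation[OF ell2_nth_summable[of c], of "e\<^sup>2 / 2"] assms by auto
  have "L2_set (\<lambda>i. cmod (ell2_nth c i)) F < e" if F: "finite F" "F \<inter> F0 = {}" for F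
  proof -
    have "sum ?q F + sum ?q F0 = sum ?q (F \<union> F0)"
      using F F0 by (simp add: sum.union_disjoint)
    also have "\<dots> \<le> infsum ?q UNIV"
      using F F0 by (intro finite_sum_le_infsum ell2_nth_summable) auto
    finally have "sum ?q F \<le> e\<^sup>2 / 2"
      using F0(2) unfolding dist_real_def by linarith
    also have "\<dots> < e\<^sup>2"
      using assms by simp
    finally have "sqrt (sum ?q F) < sqrt (e\<^sup>2)"
      by (rule real_sqrt_less_mono)
    then show ?thesis
      using assms by (simp add: L2_set_def)
  qed
  then show ?thesis
    using F0 by blast
qed

lemma has_sum_synthesis:
  fixes \<Phi> :: "'i \<Rightarrow> 'h::chilbert_space"
  assumes "bessel \<Phi>"
  shows "((\<lambda>i. ell2_nth c i *\<^sub>C \<Phi> i) has_sum synthesis \<Phi> c) UNIV"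
  unfolding synthesis_def
proof (intro has_sum_infsum summable_on_if_small_tails)
  fix e :: real assume "e > 0"
  obtain B where B: "bessel_bound \<Phi> B"
    using assms by (auto simp: bessel_def)
  then have pos: "sqrt B > 0"
    by (simp add: bessel_bound_pos)
  obtain F0 where F0: "finite F0"
    "\<And>F. finite F \<Longrightarrow> F \<inter> F0 = {} \<Longrightarrow> L2_set (\<lambda>i. cmod (ell2_nth c i)) F < e / sqrt B"
    using ell2_small_tails[of "e / sqrt B" c] \<open>e > 0\<close> pos by auto
  have "norm (\<Sum>i\<in>F. ell2_nth c i *\<^sub>C \<Phi> i) < e" if F: "finite F" "F \<inter> F0 = {}" for F
    using norm_finite_synthesis_le[OF B F(1), of "ell2_nth c"] F0(2)[OF F] pos
    by (simp add: pos_less_divide_eq mult.commute)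
  then show "\<exists>F0. finite F0 \<and> F0 \<subseteq> UNIV \<and> (\<forall>F. finite F \<and> F \<subseteq> UNIV \<and> F \<inter> F0 = {} \<longrightarrow>
      norm (\<Sum>i\<in>F. ell2_nth c i *\<^sub>C \<Phi> i) < e)"
    using F0(1) by blast
qed

lemma norm_synthesis_le:
  fixes \<Phi> :: "'i \<Rightarrow> 'h::chilbert_space"
  assumes B: "bessel_bound \<Phi> B"
  shows "norm (synthesis \<Phi> c) \<le> sqrt B * norm c"
proof (rule tendsto_upperbound)
  show "((\<lambda>F. norm (\<Sum>i\<in>F. ell2_nth c i *\<^sub>C \<Phi> i)) \<longlongrightarrow> norm (synthesis \<Phi> c))
      (finite_subsets_at_top UNIV)"
    using has_sum_synthesis[OF bessel_bound_imp_bessel[OF B], of c]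
    unfolding has_sum_def by (rule tendsto_norm)
  have "norm (\<Sum>i\<in>F. ell2_nth c i *\<^sub>C \<Phi> i) \<le> sqrt B * norm c" if "finite F" for F
  proof -
    have "norm (\<Sum>i\<in>F. ell2_nth c i *\<^sub>C \<Phi> i) \<le> sqrt B * L2_set (\<lambda>i. cmod (ell2_nth c i)) F"
      by (rule norm_finite_synthesis_le[OF B that])
    also have "\<dots> \<le> sqrt B * norm c"
      using bessel_bound_pos[OF B] by (intro mult_left_mono L2_set_ell2_le_norm[OF that]) simp
    finally show ?thesis .
  qed
  then show "\<forall>\<^sub>F F in finite_subsets_at_top UNIV.
      norm (\<Sum>i\<in>F. ell2_nth c i *\<^sub>C \<Phi> i) \<le> sqrt B * norm c"
    by (intro eventually_finite_subsets_at_top_weakI) auto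
qed simp

lemma bounded_linear_synthesis:
  fixes \<Phi> :: "'i \<Rightarrow> 'h::chilbert_space"
  assumes "bessel \<Phi>"
  shows "bounded_linear (synthesis \<Phi>)"
proof -
  obtain B where B: "bessel_bound \<Phi> B"
    using assms by (auto simp: bessel_def)
  note sums = has_sum_synthesis[OF assms]
  show ?thesis
  proof (rule bounded_linear_intro[where K = "sqrt B"])
    show "synthesis \<Phi> (c + d) = synthesis \<Phi> c + synthesis \<Phi> d" for c d
    proof (rule has_sum_unique)
      show "((\<lambda>i. ell2_nth c i *\<^sub>C \<Phi> i + ell2_nth d i *\<^sub>C \<Phi> i) has_sum
          synthesis \<Phi> (c + d)) UNIV"
        using sums[of "c + d"] by (simp add: plus_ell2.rep_eq scaleC_add_left)
    qed (rule has_sum_add[OF sums sums])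
    show "synthesis \<Phi> (r *\<^sub>R c) = r *\<^sub>R synthesis \<Phi> c" for r c
    proof (rule has_sum_unique)
      have "ell2_nth (r *\<^sub>R c) i *\<^sub>C \<Phi> i = r *\<^sub>R (ell2_nth c i *\<^sub>C \<Phi> i)" for i
      proof -
        have "ell2_nth (r *\<^sub>R c) i *\<^sub>C \<Phi> i = (complex_of_real r * ell2_nth c i) *\<^sub>C \<Phi> i"
          by (simp only: scaleR_ell2.rep_eq scaleR_conv_of_real)
        also have "\<dots> = complex_of_real r *\<^sub>C ell2_nth c i *\<^sub>C \<Phi> i"
          by (rule scaleC_scaleC[symmetric])
        also have "\<dots> = r *\<^sub>R (ell2_nth c i *\<^sub>C \<Phi> i)"
          by (rule scaleC_of_real)
        finally show ?thesis .
      qed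
      then show "((\<lambda>i. r *\<^sub>R (ell2_nth c i *\<^sub>C \<Phi> i)) has_sum synthesis \<Phi> (r *\<^sub>R c)) UNIV"
        using sums[of "r *\<^sub>R c"] by simp
    qed (rule has_sum_bounded_linear[OF bounded_linear_scaleR_right sums])
    show "norm (synthesis \<Phi> c) \<le> norm c * sqrt B" for c
      using norm_synthesis_le[OF B, of c] by (simp add: mult.commute)
  qed
qed

lemma ell2_nth_analysis:
  assumes "bessel \<Phi>"
  shows "ell2_nth (analysis \<Phi> f) i = cinner f (\<Phi> i)"
  using assms by (auto simp: analysis_def bessel_def bessel_bound_def Abs_ell2_inverse)

lemma norm_analysis_le:
  assumes B: "bessel_bound \<Phi> B"
  shows "norm (analysis \<Phi> f) \<le> sqrt B * norm f"
proof -
  have "norm (analysis \<Phi> f) = sqrt (\<Sum>\<^sub>\<infinity>i. (cmod (cinner f (\<Phi> i)))\<^sup>2)"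
    using bessel_bound_imp_bessel[OF B] by (simp add: norm_ell2.rep_eq ell2_nth_analysis)
  also have "\<dots> \<le> sqrt (B * (norm f)\<^sup>2)"
    using B by (intro real_sqrt_le_mono) (simp add: bessel_bound_def)
  finally show ?thesis
    by (simp add: real_sqrt_mult)
qed

lemma bounded_linear_analysis:
  assumes "bessel \<Phi>"
  shows "bounded_linear (analysis \<Phi>)"
proof -
  obtain B where B: "bessel_bound \<Phi> B"
    using assms by (auto simp: bessel_def)
  show ?thesis
  proof (rule bounded_linear_intro[where K = "sqrt B"])
    show "analysis \<Phi> (f + g) = analysis \<Phi> f + analysis \<Phi> g" for f g
      by (simp add: ell2_nth_inject[symmetric] fun_eq_iff plus_ell2.rep_eq
          ell2_nth_analysis[OF assms] cinner_add_left)
    show "analysis \<Phi> (r *\<^sub>R f) = r *\<^sub>R analysis \<Phi> f" for r f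
      by (simp add: ell2_nth_inject[symmetric] fun_eq_iff scaleR_ell2.rep_eq
          ell2_nth_analysis[OF assms] cinner_scaleR_left)
    show "norm (analysis \<Phi> f) \<le> norm f * sqrt B" for f
      using norm_analysis_le[OF B, of f] by (simp add: mult.commute)
  qed
qed

section \<open>Duals and cross Gram matrices\<close>

lemma synthesis_analysis_dual:
  assumes "dual_of \<Phi>d \<Phi>"
  shows "synthesis \<Phi> (analysis \<Phi>d f) = f"
  using assms by (auto simp: dual_of_def synthesis_def ell2_nth_analysis intro: infsumI)

text \<open>
  Duality is symmetric because \<open>DT*\<close> is the adjoint of \<open>TD* = I\<close>. Without adjoints, test against a
  vector \<open>g\<close>: the series for \<open>\<langle>DT*f, g\<rangle>\<close> is, term by term, the complex conjugate of the one
  that the reconstruction of \<open>g\<close> gives for \<open>\<langle>g, f\<rangle>\<close>.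
\<close>

lemma dual_synthesis_analysis:
  fixes \<Phi> \<Phi>d :: "'i \<Rightarrow> 'h::chilbert_space"
  assumes dual: "dual_of \<Phi>d \<Phi>" and \<Phi>: "bessel \<Phi>"
  shows "synthesis \<Phi>d (analysis \<Phi> f) = f"
proof (rule cinner_eqI)
  fix g
  have \<Phi>d: "bessel \<Phi>d" and recon: "((\<lambda>i. cinner g (\<Phi>d i) *\<^sub>C \<Phi> i) has_sum g) UNIV"
    using dual by (auto simp: dual_of_def)
  have "((\<lambda>i. cinner f (\<Phi> i) * cinner (\<Phi>d i) g) has_sum
      cinner (synthesis \<Phi>d (analysis \<Phi> f)) g) UNIV"
    using has_sum_bounded_linear[OF bounded_linear_cinner_left has_sum_synthesis[OF \<Phi>d, of "analysis \<Phi> f"]]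
    by (simp add: cinner_scaleC_left ell2_nth_analysis[OF \<Phi>])
  moreover have "((\<lambda>i. cnj (cinner g (\<Phi>d i) * cinner (\<Phi> i) f)) has_sum cnj (cinner g f)) UNIV"
    unfolding has_sum_cnj_iff
    using has_sum_bounded_linear[OF bounded_linear_cinner_left recon] by (simp add: cinner_scaleC_left)
  then have "((\<lambda>i. cinner f (\<Phi> i) * cinner (\<Phi>d i) g) has_sum cinner f g) UNIV"
    by (simp add: mult.commute flip: cinner_commute)
  ultimately show "cinner (synthesis \<Phi>d (analysis \<Phi> f)) g = cinner f g"
    by (rule has_sum_unique)
qed

text \<open>
  The bounded complex-linear maps \<open>U\<close> and \<open>\<langle>\<cdot>, \<phi>\<^sub>i\<rangle>\<close> can be pulled out of the series in each matrix
  row, so the matrix acts as the expected composition.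
\<close>

lemma cross_gram_eq:
  fixes \<Phi> \<Psi> :: "'i \<Rightarrow> 'h::chilbert_space"
  assumes U: "bounded_clinear U" and \<Psi>: "bessel \<Psi>"
  shows "cross_gram U \<Phi> \<Psi> c = analysis \<Phi> (U (synthesis \<Psi> c))"
proof -
  have "bounded_linear (\<lambda>x. cinner (U x) (\<Phi> i))" for i
    using U bounded_linear_compose[OF bounded_linear_cinner_left] by (auto simp: bounded_clinear_def)
  from has_sum_bounded_linear[OF this has_sum_synthesis[OF \<Psi>]] U
  have "((\<lambda>j. cinner (U (\<Psi> j)) (\<Phi> i) * ell2_nth c j) has_sum
      cinner (U (synthesis \<Psi> c)) (\<Phi> i)) UNIV" for i
    by (simp add: bounded_clinear_def cinner_scaleC_left mult.commute)
  then have "(\<Sum>\<^sub>\<infinity>j. cinner (U (\<Psi> j)) (\<Phi> i) * ell2_nth c j) = cinner (U (synthesis \<Psi> c)) (\<Phi> i)" for i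
    by (rule infsumI)
  then show ?thesis
    by (simp add: cross_gram_def matrix_op_def cross_gram_matrix_def analysis_def)
qed

lemma bounded_clinear_id: "bounded_clinear id"
  by (simp add: bounded_clinear_def id_def)

lemma gram_eq:
  fixes \<Phi> \<Psi> :: "'i \<Rightarrow> 'h::chilbert_space"
  assumes "bessel \<Psi>"
  shows "gram \<Phi> \<Psi> c = analysis \<Phi> (synthesis \<Psi> c)"
  using cross_gram_eq[OF bounded_clinear_id assms] by simp

section \<open>Compressing the distance of a Gram matrix from the identity\<close>

lemma onorm_sandwich_less_1:
  fixes \<Theta> \<Omega> :: "'i \<Rightarrow> 'h::chilbert_space"
  assumes \<Theta>: "bessel_bound \<Theta> B" and \<Omega>: "bessel_bound \<Omega> C"
    and M: "bounded_linear M" "onorm M < 1 / sqrt (B * C)"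
  shows "onorm (\<lambda>f. synthesis \<Theta> (M (analysis \<Omega> f))) < 1"
proof -
  have pos: "sqrt (B * C) > 0"
    using bessel_bound_pos[OF \<Theta>] bessel_bound_pos[OF \<Omega>] by simp
  have "norm (synthesis \<Theta> (M (analysis \<Omega> f))) \<le> (sqrt (B * C) * onorm M) * norm f" for f
  proof -
    have "norm (synthesis \<Theta> (M (analysis \<Omega> f))) \<le> sqrt B * norm (M (analysis \<Omega> f))"
      by (rule norm_synthesis_le[OF \<Theta>])
    also have "\<dots> \<le> sqrt B * (onorm M * norm (analysis \<Omega> f))"
      using bessel_bound_pos[OF \<Theta>] by (intro mult_left_mono onorm[OF M(1)]) simp
    also have "\<dots> \<le> sqrt B * (onorm M * (sqrt C * norm f))"
      using bessel_bound_pos[OF \<Theta>] onorm_pos_le[OF M(1)]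
      by (intro mult_left_mono norm_analysis_le[OF \<Omega>]) auto
    finally show ?thesis
      by (simp add: real_sqrt_mult mult_ac)
  qed
  then have "onorm (\<lambda>f. synthesis \<Theta> (M (analysis \<Omega> f))) \<le> sqrt (B * C) * onorm M"
    using pos onorm_pos_le[OF M(1)] by (intro onorm_bound) auto
  also have "\<dots> < 1"
    using M(2) pos by (simp add: pos_less_divide_eq mult.commute)
  finally show ?thesis .
qed

text \<open>
  The four sequences are independent here, so that each claim is obtained by choosing them in such
  a way that duality reduces one of the two terms to the identity and the other to a single
  synthesis after a single analysis.
\<close>

lemma onorm_compressed_defect_less_1:
  fixes \<Phi> \<Psi> \<Theta> \<Omega> :: "'i \<Rightarrow> 'h::chilbert_space"
  assumes \<Theta>: "bessel_bound \<Theta> B" and \<Omega>: "bessel_bound \<Omega> C"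
    and \<Phi>: "bessel \<Phi>" and \<Psi>: "bessel \<Psi>"
    and small: "onorm (\<lambda>c. c - gram \<Phi> \<Psi> c) < 1 / sqrt (B * C)"
  shows "onorm (\<lambda>f. synthesis \<Theta> (analysis \<Omega> f)
    - synthesis \<Theta> (analysis \<Phi> (synthesis \<Psi> (analysis \<Omega> f)))) < 1"
proof -
  interpret S: bounded_linear "synthesis \<Theta>"
    by (rule bounded_linear_synthesis[OF bessel_bound_imp_bessel[OF \<Theta>]])
  let ?M = "\<lambda>c. c - analysis \<Phi> (synthesis \<Psi> c)"
  have "bounded_linear ?M"
    by (intro bounded_linear_sub bounded_linear_ident
        bounded_linear_compose[OF bounded_linear_analysis[OF \<Phi>] bounded_linear_synthesis[OF \<Psi>]])
  moreover have "onorm ?M < 1 / sqrt (B * C)"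
    using small by (simp add: gram_eq[OF \<Psi>])
  ultimately have "onorm (\<lambda>f. synthesis \<Theta> (?M (analysis \<Omega> f))) < 1"
    by (rule onorm_sandwich_less_1[OF \<Theta> \<Omega>])
  then show ?thesis
    by (simp add: S.diff)
qed

theorem proposition5p1:
  fixes \<Phi> \<Psi> \<Phi>d \<Psi>d :: "'i::countable \<Rightarrow> 'h::chilbert_space"
    and B\<Phi> B\<Phi>d B\<Psi>d :: real
  assumes "separable_space (euclidean :: 'h topology)"
    and "frame \<Phi>" and "frame \<Psi>"
    and "dual_of \<Phi>d \<Phi>" and "dual_of \<Psi>d \<Psi>"
    and "bessel_bound \<Phi> B\<Phi>" and "bessel_bound \<Phi>d B\<Phi>d" and "bessel_bound \<Psi>d B\<Psi>d"
  shows "(onorm (\<lambda>c. c - gram \<Psi> \<Phi> c) < 1 / sqrt (B\<Phi> * B\<Phi>d) \<longrightarrow> approx_dual_frames \<Phi> \<Psi>)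
    \<and> (onorm (\<lambda>c. c - gram \<Phi> \<Psi> c) < 1 / sqrt (B\<Phi>d * B\<Psi>d) \<longrightarrow> approx_dual_frames \<Phi>d \<Psi>d)
    \<and> (onorm (\<lambda>c. c - gram \<Phi> \<Psi> c) < 1 / sqrt (B\<Phi> * B\<Phi>d) \<longrightarrow> approx_dual_frames \<Phi> \<Psi>)
    \<and> (\<forall>U V :: 'h \<Rightarrow> 'h. bounded_clinear U \<longrightarrow> bounded_clinear V \<longrightarrow> U \<circ> V = id \<longrightarrow>
         onorm (\<lambda>c. c - cross_gram U \<Psi> \<Phi> (cross_gram V \<Phi>d \<Phi> c)) < 1 / sqrt (B\<Phi> * B\<Phi>d) \<longrightarrow>
         approx_dual_frames \<Phi> \<Psi>)"
proof -
  have bessel: "bessel \<Phi>" "bessel \<Psi>" "bessel \<Phi>d" "bessel \<Psi>d"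
    using assms(2-5) by (simp_all add: frame_def dual_of_def)
  note \<Phi>\<Phi>d = synthesis_analysis_dual[OF assms(4)]
  note \<Psi>\<Psi>d = synthesis_analysis_dual[OF assms(5)]
  note \<Phi>d\<Phi> = dual_synthesis_analysis[OF assms(4) bessel(1)]
  have *: "onorm (\<lambda>f. F f - G f) < 1" if "onorm (\<lambda>f. G f - F f) < 1" for F G :: "'h \<Rightarrow> 'h"
    using that onorm_neg[of "\<lambda>f. G f - F f"] by simp
  have 1: "approx_dual_frames \<Phi> \<Psi>"
    if "onorm (\<lambda>c. c - gram \<Psi> \<Phi> c) < 1 / sqrt (B\<Phi> * B\<Phi>d)"
    using *[OF onorm_compressed_defect_less_1[OF assms(6,7) bessel(2,1) that]] bessel
    by (simp add: \<Phi>\<Phi>d approx_dual_frames_def)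
  have 2: "approx_dual_frames \<Phi>d \<Psi>d"
    if "onorm (\<lambda>c. c - gram \<Phi> \<Psi> c) < 1 / sqrt (B\<Phi>d * B\<Psi>d)"
    using onorm_compressed_defect_less_1[OF assms(7,8) bessel(1,2) that] bessel
    by (simp add: \<Psi>\<Psi>d \<Phi>d\<Phi> approx_dual_frames_def)
  have 3: "approx_dual_frames \<Phi> \<Psi>"
    if "onorm (\<lambda>c. c - gram \<Phi> \<Psi> c) < 1 / sqrt (B\<Phi> * B\<Phi>d)"
    using *[OF onorm_compressed_defect_less_1[OF assms(7,6) bessel(1,2)]] that bessel
    by (simp add: \<Phi>d\<Phi> approx_dual_frames_def mult.commute)
  have 4: "approx_dual_frames \<Phi> \<Psi>"
    if UV: "bounded_clinear U" "bounded_clinear V" "U \<circ> V = id"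
      and small: "onorm (\<lambda>c. c - cross_gram U \<Psi> \<Phi> (cross_gram V \<Phi>d \<Phi> c)) < 1 / sqrt (B\<Phi> * B\<Phi>d)"
    for U V :: "'h \<Rightarrow> 'h"
  proof (rule 1)
    have "cross_gram U \<Psi> \<Phi> (cross_gram V \<Phi>d \<Phi> c) = gram \<Psi> \<Phi> c" for c
      using UV(3) by (simp add: cross_gram_eq[OF UV(1) bessel(1)] cross_gram_eq[OF UV(2) bessel(1)]
          gram_eq[OF bessel(1)] \<Phi>\<Phi>d pointfree_idE)
    then show "onorm (\<lambda>c. c - gram \<Psi> \<Phi> c) < 1 / sqrt (B\<Phi> * B\<Phi>d)"
      using small by simp
  qed
  show ?thesis
    using 1 2 3 4 by blast
qed

end
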